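(* Let $n\ge 2$ and $k\in(0,\infty)$. Let $\tau^*\in(0,1)$ be the solution of $$\tau^* = \frac{k\, f\bigl(1-(1-\tau^* )^n\bigr)}{n-(n-k)\, f\bigl(1-(1-\tau^* )^n\bigr)},$$ so that $(\tau^*,\dots,\tau^* )$ is a Nash equilibrium of the distributed access game, and let $\tau_x\in(0,1)$ be the point at which the homogeneous uplink throughput $S_u^{hom}$ attains its single maximum. If $\tau^*\le\tau_x$, then the Nash equilibrium $(\tau^*,\tau^*,\dots,\tau^* )$ is Pareto optimal.
   Context: Parameters: an integer $n\ge 2$ (number of stations), real constants $P>0$ (payload) and $0<\sigma<T$ (empty and busy slot durations), an integer retry limit $R\ge 0$, contention windows $1<CW_{min}\le CW_{max}$, $W(i)=\min\{2^i CW_{min},CW_{max}\}$. Define $f:[0,1]\to(0,1)$ by $$f(p)=\frac{2(1-p^{R+1})}{1-p^{R+1}+(1-p)\sum_{i=0}^R p^iW(i)}\ \ (0\le p<1),\qquad f(1)=\frac{2(R+1)}{1+\sum_{i=0}^R W(i)}.$$ Game: each player (station) $i\in\{1,\dots,n\}$ chooses $\tau_i\in[0,1]$. For $\boldsymbol\tau\in[0,1]^n$ put $p_i=1-\prod_{j\ne i}(1-\tau_j)$, $p_{AP}=1-\prod_{j=1}^n(1-\tau_j)$, $\tau_{AP}=f(p_{AP})$, $P_{idle}=(1-p_{AP})(1-\tau_{AP})$, and $$S_u^i=\frac{\tau_i(1-p_i)(1-\tau_{AP})P}{P_{idle}\sigma+(1-P_{idle})T},\qquad S_d=\frac1n\,\frac{\tau_{AP}(1-p_{AP})P}{P_{idle}\sigma+(1-P_{idle})T}.$$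 The utility of station $i$ is $J_i(\boldsymbol\tau)=\min\{S_u^i,kS_d\}$. For $\tau\in[0,1]$, $S_u^{hom}(\tau)$ denotes the common value of the $S_u^i$ at the homogeneous outcome $(\tau,\dots,\tau)$. Standing fact taken as given: $S_u^{hom}$ is non-monotonic with a single maximum at a point $\tau_x\in(0,1)$, meaning that it is strictly increasing on $[0,\tau_x]$ and strictly decreasing on $[\tau_x,1]$. The equation defining $\tau^*$ has exactly one solution in $(0,1)$. A Nash equilibrium is a vector $\boldsymbol\tau\in[0,1]^n$ such that no player $i$ can strictly increase $J_i$ by changing $\tau_i\in[0,1]$ alone. A vector $\boldsymbol\tau\in[0,1]^n$ is Pareto optimal if there is no $\boldsymbol\rho\in[0,1]^n$ with $J_i(\boldsymbol\rho)\ge J_i(\boldsymbol\tau)$ for all $i$ and $J_j(\boldsymbol\rho)>J_j(\boldsymbol\tau)$ for some $j$. *)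

theory Defs
  imports Complex_Main
begin

text \<open>
  Stations are numbered \<open>1, \<dots>, n\<close>. A strategy vector is a function \<open>nat \<Rightarrow> real\<close> of which only
  the values on \<open>{1..n}\<close> matter; every definition below reads it on that set only.
\<close>

definition window :: "real \<Rightarrow> real \<Rightarrow> nat \<Rightarrow> real" where
  "window CWmin CWmax i = min (2 ^ i * CWmin) CWmax"

text \<open>Attempt probability of a saturated node as a function of its conditional collision
  probability; meant for \<open>p \<in> {0..1}\<close>.\<close>

definition attempt_prob :: "nat \<Rightarrow> real \<Rightarrow> real \<Rightarrow> real \<Rightarrow> real" where
  "attempt_prob R CWmin CWmax p =
     (if p = 1 then 2 * (real R + 1) / (1 + (\<Sum>i=0..R. window CWmin CWmax i))
      else 2 * (1 - p ^ (R + 1)) /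
             (1 - p ^ (R + 1) + (1 - p) * (\<Sum>i=0..R. p ^ i * window CWmin CWmax i)))"

definition p_station :: "nat \<Rightarrow> (nat \<Rightarrow> real) \<Rightarrow> nat \<Rightarrow> real" where
  "p_station n \<tau> i = 1 - (\<Prod>j\<in>{1..n} - {i}. 1 - \<tau> j)"

definition p_AP :: "nat \<Rightarrow> (nat \<Rightarrow> real) \<Rightarrow> real" where
  "p_AP n \<tau> = 1 - (\<Prod>j\<in>{1..n}. 1 - \<tau> j)"

text \<open>In the following the argument \<open>f\<close> stands for \<open>attempt_prob R CWmin CWmax\<close>.\<close>

definition tau_AP :: "(real \<Rightarrow> real) \<Rightarrow> nat \<Rightarrow> (nat \<Rightarrow> real) \<Rightarrow> real" where
  "tau_AP f n \<tau> = f (p_AP n \<tau>)"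

definition P_idle :: "(real \<Rightarrow> real) \<Rightarrow> nat \<Rightarrow> (nat \<Rightarrow> real) \<Rightarrow> real" where
  "P_idle f n \<tau> = (1 - p_AP n \<tau>) * (1 - tau_AP f n \<tau>)"

definition S_up ::
  "(real \<Rightarrow> real) \<Rightarrow> nat \<Rightarrow> real \<Rightarrow> real \<Rightarrow> real \<Rightarrow> (nat \<Rightarrow> real) \<Rightarrow> nat \<Rightarrow> real" where
  "S_up f n P \<sigma> T \<tau> i =
     \<tau> i * (1 - p_station n \<tau> i) * (1 - tau_AP f n \<tau>) * P /
       (P_idle f n \<tau> * \<sigma> + (1 - P_idle f n \<tau>) * T)"

definition S_down ::
  "(real \<Rightarrow> real) \<Rightarrow> nat \<Rightarrow> real \<Rightarrow> real \<Rightarrow> real \<Rightarrow> (nat \<Rightarrow> real) \<Rightarrow> real" where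
  "S_down f n P \<sigma> T \<tau> =
     1 / real n * (tau_AP f n \<tau> * (1 - p_AP n \<tau>) * P /
       (P_idle f n \<tau> * \<sigma> + (1 - P_idle f n \<tau>) * T))"

definition utility ::
  "(real \<Rightarrow> real) \<Rightarrow> nat \<Rightarrow> real \<Rightarrow> real \<Rightarrow> real \<Rightarrow> real \<Rightarrow> (nat \<Rightarrow> real) \<Rightarrow> nat \<Rightarrow> real" where
  "utility f n k P \<sigma> T \<tau> i = min (S_up f n P \<sigma> T \<tau> i) (k * S_down f n P \<sigma> T \<tau>)"

text \<open>The choice of station 1 is immaterial, see \<open>S_up_homogeneous\<close>.\<close>

definition S_up_hom :: "(real \<Rightarrow> real) \<Rightarrow> nat \<Rightarrow> real \<Rightarrow> real \<Rightarrow> real \<Rightarrow> real \<Rightarrow> real" where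
  "S_up_hom f n P \<sigma> T t = S_up f n P \<sigma> T (\<lambda>_. t) 1"

lemma S_up_homogeneous:
  assumes "i \<in> {1..n}"
  shows "S_up f n P \<sigma> T (\<lambda>_. t) i = S_up_hom f n P \<sigma> T t"
  using assms by (simp add: S_up_hom_def S_up_def p_station_def card_Diff_singleton)

definition outcome :: "nat \<Rightarrow> (nat \<Rightarrow> real) \<Rightarrow> bool" where
  "outcome n \<tau> \<longleftrightarrow> (\<forall>i\<in>{1..n}. \<tau> i \<in> {0..1})"

definition nash_equilibrium ::
  "nat \<Rightarrow> ((nat \<Rightarrow> real) \<Rightarrow> nat \<Rightarrow> real) \<Rightarrow> (nat \<Rightarrow> real) \<Rightarrow> bool" where
  "nash_equilibrium n J \<tau> \<longleftrightarrow>
     outcome n \<tau> \<and> \<not> (\<exists>i\<in>{1..n}. \<exists>t\<in>{0..1}. J (\<tau>(i := t)) i > J \<tau> i)"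

definition pareto_optimal ::
  "nat \<Rightarrow> ((nat \<Rightarrow> real) \<Rightarrow> nat \<Rightarrow> real) \<Rightarrow> (nat \<Rightarrow> real) \<Rightarrow> bool" where
  "pareto_optimal n J \<tau> \<longleftrightarrow>
     outcome n \<tau> \<and>
     \<not> (\<exists>\<rho>. outcome n \<rho> \<and> (\<forall>i\<in>{1..n}. J \<rho> i \<ge> J \<tau> i) \<and> (\<exists>j\<in>{1..n}. J \<rho> j > J \<tau> j))"

end

theory Submission imports Defs begin

text \<open>
  All stations together affect the downlink only through the idle product
  \<open>q = (\<Prod>j. 1 - \<tau> j)\<close>, and the downlink throughput is nondecreasing in \<open>q\<close>. The equation for
  \<open>\<tau>s\<close> says that uplink and scaled downlink throughput coincide there. A station that raises its
  \<open>\<tau> i\<close> does not raise the downlink, one that reduces it does not raise its own uplink, hence the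
  equilibrium.

  A vector \<open>\<rho>\<close> that dominates \<open>\<tau>s\<close> has a strictly larger downlink throughput, so a larger
  product \<open>q\<close>, and \<open>q\<close> is also the product of a homogeneous outcome \<open>t < \<tau>s\<close>. Some station has
  \<open>\<rho> i \<le> t\<close>, and its uplink throughput is then at most the homogeneous one at \<open>t\<close>, which is less
  than the one at \<open>\<tau>s\<close> because \<open>\<tau>s \<le> \<tau>x\<close>.

  The value of the attempt probability at \<open>p = 1\<close>, that is \<open>q = 0\<close>, is not its limit: the
  denominator has \<open>1\<close> in the place of \<open>R + 1\<close>, so this value may exceed \<open>1\<close>. This does no harm, as
  the downlink throughput, and with it every utility, is then at most \<open>0\<close>.
\<close>

section \<open>Contention windows and the attempt probability on [0,1)\<close>

lemma window_mono:
  assumes "0 \<le> CWmin" "i \<le> j"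
  shows "window CWmin CWmax i \<le> window CWmin CWmax j"
proof -
  have "2 ^ i * CWmin \<le> 2 ^ j * CWmin"
    using assms by (intro mult_right_mono power_increasing) auto
  then show ?thesis by (auto simp: window_def)
qed

lemma window_gt_1:
  assumes "1 < CWmin" "CWmin \<le> CWmax"
  shows "1 < window CWmin CWmax i"
proof -
  have "1 < window CWmin CWmax 0" using assms by (simp add: window_def)
  also have "\<dots> \<le> window CWmin CWmax i" using assms by (intro window_mono) auto
  finally show ?thesis .
qed

text \<open>Cancelling 1 - p leaves 2A / (A + B), with A the sum of the p^i and B that of the p^i
  W(i). Bounds then reduce to A < B, monotonicity to that of B / A.\<close>

lemma attempt_prob_eq:
  assumes "p \<noteq> 1"
  shows "attempt_prob R CWmin CWmax p =
    2 * (\<Sum>i\<le>R. p ^ i) / ((\<Sum>i\<le>R. p ^ i) + (\<Sum>i\<le>R. p ^ i * window CWmin CWmax i))"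
proof -
  have "1 - p ^ (R + 1) = (1 - p) * (\<Sum>i\<le>R. p ^ i)"
    using sum_gp_basic[of p R] by simp
  then show ?thesis
    using assms
    by (simp add: attempt_prob_def atLeast0AtMost mult.left_commute flip: distrib_left)
qed

lemma attempt_prob_bounds:
  assumes "1 < CWmin" "CWmin \<le> CWmax" "0 \<le> p" "p < 1"
  shows "0 < attempt_prob R CWmin CWmax p" "attempt_prob R CWmin CWmax p < 1"
proof -
  let ?a = "\<Sum>i\<le>R. p ^ i" and ?b = "\<Sum>i\<le>R. p ^ i * window CWmin CWmax i"
  have a: "0 < ?a"
    by (rule sum_pos2[where i = 0]) (use assms in auto)
  have "?a < ?b"
  proof (rule sum_strict_mono_ex1)
    show "\<forall>i\<in>{..R}. p ^ i \<le> p ^ i * window CWmin CWmax i"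
      using window_gt_1[OF assms(1,2)] assms(3) by (auto intro!: mult_left_le less_imp_le simp: mult_le_cancel_left1)
    \<comment> \<open>Index 0 is strict even for p = 0, because p^0 = 1.\<close>
    show "\<exists>i\<in>{..R}. p ^ i < p ^ i * window CWmin CWmax i"
      using window_gt_1[OF assms(1,2), of 0] by (intro bexI[of _ 0]) auto
  qed simp
  with a show "0 < attempt_prob R CWmin CWmax p" "attempt_prob R CWmin CWmax p < 1"
    using assms(4) by (auto simp: attempt_prob_eq)
qed

lemma power_cross_mono:
  fixes p r :: real
  assumes "0 \<le> p" "p \<le> r" "i \<le> j"
  shows "p ^ j * r ^ i \<le> p ^ i * r ^ j"
proof -
  obtain d where "j = i + d" using assms(3) le_Suc_ex by blast
  moreover have "p ^ i * r ^ i * p ^ d \<le> p ^ i * r ^ i * r ^ d"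
    using assms by (intro mult_left_mono power_mono) auto
  ultimately show ?thesis by (simp add: power_add ac_simps)
qed

text \<open>Symmetrising the double sum makes every summand a product of two differences of equal sign,
  as in Chebyshev's sum inequality.\<close>

lemma sum_power_cross_mono:
  fixes p r :: real and w :: "nat \<Rightarrow> real"
  assumes "0 \<le> p" "p \<le> r" and w: "\<And>i j. i \<le> j \<Longrightarrow> w i \<le> w j"
  shows "(\<Sum>i\<le>R. p ^ i * w i) * (\<Sum>i\<le>R. r ^ i) \<le> (\<Sum>i\<le>R. r ^ i * w i) * (\<Sum>i\<le>R. p ^ i)"
proof -
  let ?d = "\<lambda>i j. p ^ i * r ^ j * (w j - w i)"
  have diff: "(\<Sum>i\<le>R. r ^ i * w i) * (\<Sum>i\<le>R. p ^ i) - (\<Sum>i\<le>R. p ^ i * w i) * (\<Sum>i\<le>R. r ^ i)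
      = (\<Sum>i\<le>R. \<Sum>j\<le>R. ?d i j)"
  proof -
    have "(\<Sum>i\<le>R. r ^ i * w i) * (\<Sum>i\<le>R. p ^ i) = (\<Sum>i\<le>R. \<Sum>j\<le>R. p ^ i * (r ^ j * w j))"
      by (subst mult.commute) (rule sum_product)
    moreover have "(\<Sum>i\<le>R. p ^ i * w i) * (\<Sum>i\<le>R. r ^ i) = (\<Sum>i\<le>R. \<Sum>j\<le>R. p ^ i * w i * r ^ j)"
      by (rule sum_product)
    ultimately show ?thesis
      by (simp only: flip: sum_subtractf) (simp add: algebra_simps)
  qed
  have pair: "0 \<le> ?d i j + ?d j i" if "i \<le> j" for i j
  proof -
    have "?d i j + ?d j i = (p ^ i * r ^ j - p ^ j * r ^ i) * (w j - w i)"
      by (simp add: algebra_simps)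
    also have "\<dots> \<ge> 0"
      using power_cross_mono[OF assms(1,2) that] w[OF that] by simp
    finally show ?thesis .
  qed
  then have pair': "0 \<le> ?d i j + ?d j i" for i j
    by (metis add.commute linear)
  have "(\<Sum>i\<le>R. \<Sum>j\<le>R. ?d i j) = (\<Sum>i\<le>R. \<Sum>j\<le>R. ?d j i)"
    by (rule sum.swap)
  then have "2 * (\<Sum>i\<le>R. \<Sum>j\<le>R. ?d i j) = (\<Sum>i\<le>R. \<Sum>j\<le>R. ?d i j + ?d j i)"
    by (simp add: sum.distrib)
  also have "\<dots> \<ge> 0"
    by (intro sum_nonneg pair')
  finally show ?thesis using diff by simp
qed

text \<open>B / A is the mean of the windows with weights p^i. A larger p shifts weight to later
  windows, which are at least as large, so 2 / (1 + B / A) does not grow.\<close>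

lemma attempt_prob_antimono:
  assumes "1 < CWmin" "CWmin \<le> CWmax" "0 \<le> p" "p \<le> r" "r < 1"
  shows "attempt_prob R CWmin CWmax r \<le> attempt_prob R CWmin CWmax p"
proof -
  let ?w = "window CWmin CWmax"
  have a: "0 < (\<Sum>i\<le>R. x ^ i)" "0 \<le> (\<Sum>i\<le>R. x ^ i * ?w i)" if "0 \<le> x" for x :: real
  proof -
    show "0 < (\<Sum>i\<le>R. x ^ i)"
      by (rule sum_pos2[where i = 0]) (use that in auto)
    have "0 \<le> ?w i" for i using window_gt_1[OF assms(1,2), of i] by simp
    then show "0 \<le> (\<Sum>i\<le>R. x ^ i * ?w i)" using that by (intro sum_nonneg) simp
  qed
  have "(\<Sum>i\<le>R. p ^ i * ?w i) * (\<Sum>i\<le>R. r ^ i) \<le> (\<Sum>i\<le>R. r ^ i * ?w i) * (\<Sum>i\<le>R. p ^ i)"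
    using assms by (intro sum_power_cross_mono window_mono) auto
  moreover have "0 \<le> r" using assms by simp
  ultimately show ?thesis
    using a[of p] a[of r] assms
    by (simp add: attempt_prob_eq frac_le_eq divide_le_eq le_divide_eq add_pos_nonneg field_simps)
qed

section \<open>Monotonicity of the throughput ratios as real functions\<close>

lemma frac_le_cross:
  fixes a b x y :: real
  assumes "0 < x" "0 < y" "0 \<le> b * x - a * y"
  shows "a / x \<le> b / y"
  using assms by (simp add: pos_divide_le_eq pos_le_divide_eq)

text \<open>In the next two lemmas \<open>c\<close> stands for \<open>T - \<sigma>\<close>; in the second one \<open>a\<close> is the product of
  \<open>1 - \<tau> j\<close> over the other stations and \<open>g\<close> is \<open>1 - \<tau>AP\<close>.\<close>

lemma down_ratio_mono:
  fixes q q' f f' c T :: real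
  assumes "0 \<le> q" "q \<le> q'" "q' \<le> 1" "0 \<le> f" "f \<le> f'" "f' \<le> 1" "0 \<le> c" "c < T"
  shows "f * q / (T - c * (q * (1 - f))) \<le> f' * q' / (T - c * (q' * (1 - f')))"
proof -
  have pos: "0 < T - c * (x * (1 - y))" if "0 \<le> x" "x \<le> 1" "0 \<le> y" "y \<le> 1" for x y
  proof -
    have "c * (x * (1 - y)) \<le> c * 1"
      using that assms by (intro mult_left_mono mult_le_one) auto
    then show ?thesis using assms by simp
  qed
  \<comment> \<open>In the terms with c the product f f' cancels, leaving -c q q' (f' - f), which T
    absorbs.\<close>
  have "f' * q' * (T - c * (q * (1 - f))) - f * q * (T - c * (q' * (1 - f')))
      = (T - c * q) * (q' * (f' - f)) + T * (f * (q' - q))"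
    by (simp add: algebra_simps)
  also have "\<dots> \<ge> 0"
  proof -
    have "c * q \<le> c * 1" using assms by (intro mult_left_mono) auto
    then show ?thesis using assms by (intro add_nonneg_nonneg mult_nonneg_nonneg) auto
  qed
  finally show ?thesis
    using frac_le_cross pos[of q f] pos[of q' f'] assms by simp
qed

lemma up_ratio_mono:
  fixes t t' a g g' c T :: real
  assumes "0 \<le> t" "t \<le> t'" "t' \<le> 1" "0 \<le> a" "a \<le> 1" "0 \<le> g" "g \<le> g'" "g' \<le> 1"
    and "0 \<le> c" "c < T"
  shows "t * a * g / (T - c * ((1 - t) * a * g)) \<le> t' * a * g' / (T - c * ((1 - t') * a * g'))"
proof -
  have pos: "0 < T - c * ((1 - x) * a * y)" if "0 \<le> x" "x \<le> 1" "0 \<le> y" "y \<le> 1" for x y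
  proof -
    have "c * ((1 - x) * a * y) \<le> c * 1"
      using that assms by (intro mult_left_mono mult_le_one mult_nonneg_nonneg) auto
    then show ?thesis using assms by simp
  qed
  \<comment> \<open>Here t t' cancels in the terms with c, leaving a multiple of t' - t.\<close>
  have "t' * a * g' * (T - c * ((1 - t) * a * g)) - t * a * g * (T - c * ((1 - t') * a * g'))
      = a * (T * (t * (g' - g)) + (g' * (t' - t)) * (T - c * (a * g)))"
    by (simp add: algebra_simps)
  also have "\<dots> \<ge> 0"
  proof -
    have "c * (a * g) \<le> c * 1" using assms by (intro mult_left_mono mult_le_one) auto
    then show ?thesis
      using assms by (intro add_nonneg_nonneg mult_nonneg_nonneg) auto
  qed
  finally show ?thesis
    using frac_le_cross pos[of t g] pos[of t' g'] assms by simp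
qed

section \<open>The game for an abstract attempt probability\<close>

text \<open>The conditions on \<open>f\<close> stop short of p = 1, where
  \<open>attempt_prob\<close> may exceed 1.\<close>

locale access_game =
  fixes f :: "real \<Rightarrow> real" and n :: nat and P \<sigma> T :: real
  assumes n_pos: "0 < n" and P_pos: "0 < P" and sigma_pos: "0 < \<sigma>" and sigma_less: "\<sigma> < T"
    and f_pos: "\<And>p. 0 \<le> p \<Longrightarrow> p < 1 \<Longrightarrow> 0 < f p"
    and f_less_1: "\<And>p. 0 \<le> p \<Longrightarrow> p < 1 \<Longrightarrow> f p < 1"
    and f_antimono: "\<And>p r. 0 \<le> p \<Longrightarrow> p \<le> r \<Longrightarrow> r < 1 \<Longrightarrow> f r \<le> f p"
begin

definition idle :: "(nat \<Rightarrow> real) \<Rightarrow> real" where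
  "idle \<tau> = (\<Prod>j\<in>{1..n}. 1 - \<tau> j)"

definition idle_others :: "(nat \<Rightarrow> real) \<Rightarrow> nat \<Rightarrow> real" where
  "idle_others \<tau> i = (\<Prod>j\<in>{1..n} - {i}. 1 - \<tau> j)"

text \<open>The mean slot duration, the common denominator of all throughputs, as a function of the
  idle product alone.\<close>

definition slot :: "real \<Rightarrow> real" where
  "slot q = T - (T - \<sigma>) * (q * (1 - f (1 - q)))"

lemma S_up_eq:
  "S_up f n P \<sigma> T \<tau> i = \<tau> i * idle_others \<tau> i * (1 - f (1 - idle \<tau>)) * P / slot (idle \<tau>)"
  by (simp add: S_up_def P_idle_def tau_AP_def p_AP_def p_station_def idle_def idle_others_def
      slot_def algebra_simps)

lemma S_down_eq:
  "S_down f n P \<sigma> T \<tau> = P / real n * (f (1 - idle \<tau>) * idle \<tau> / slot (idle \<tau>))"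
  by (simp add: S_down_def P_idle_def tau_AP_def p_AP_def idle_def slot_def algebra_simps)

lemma idle_split: "i \<in> {1..n} \<Longrightarrow> idle \<tau> = (1 - \<tau> i) * idle_others \<tau> i"
  unfolding idle_def idle_others_def by (subst prod.remove) auto

lemma idle_const [simp]: "idle (\<lambda>_. t) = (1 - t) ^ n"
  by (simp add: idle_def)

lemma idle_others_const: "i \<in> {1..n} \<Longrightarrow> idle_others (\<lambda>_. t) i = (1 - t) ^ (n - 1)"
  by (simp add: idle_others_def card_Diff_singleton)

lemma idle_others_upd [simp]: "idle_others (\<tau>(i := t)) i = idle_others \<tau> i"
  unfolding idle_others_def by (intro prod.cong) auto

lemma idle_bounds: "outcome n \<tau> \<Longrightarrow> 0 \<le> idle \<tau>" "outcome n \<tau> \<Longrightarrow> idle \<tau> \<le> 1"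
  unfolding idle_def outcome_def by (auto intro!: prod_nonneg prod_le_1)

lemma idle_others_bounds:
  "outcome n \<tau> \<Longrightarrow> 0 \<le> idle_others \<tau> i" "outcome n \<tau> \<Longrightarrow> idle_others \<tau> i \<le> 1"
  unfolding idle_others_def outcome_def by (auto intro!: prod_nonneg prod_le_1)

lemma f_bounds:
  assumes "0 < q" "q \<le> 1"
  shows "0 < f (1 - q)" "f (1 - q) < 1"
  using assms f_pos[of "1 - q"] f_less_1[of "1 - q"] by auto

lemma slot_pos:
  assumes "0 < q" "q \<le> 1"
  shows "0 < slot q"
proof -
  have "(T - \<sigma>) * (q * (1 - f (1 - q))) \<le> (T - \<sigma>) * 1"
    using f_bounds[OF assms] assms sigma_less by (intro mult_left_mono mult_le_one) auto
  then show ?thesis using sigma_pos by (simp add: slot_def)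
qed

lemma S_down_pos:
  assumes "outcome n \<tau>" "0 < idle \<tau>"
  shows "0 < S_down f n P \<sigma> T \<tau>"
  using assms f_bounds[of "idle \<tau>"] slot_pos[of "idle \<tau>"] idle_bounds[of \<tau>] n_pos P_pos
  by (simp add: S_down_eq)

lemma S_down_mono:
  assumes "outcome n \<tau>" "outcome n \<rho>" "0 < idle \<rho>" "idle \<tau> \<le> idle \<rho>"
  shows "S_down f n P \<sigma> T \<tau> \<le> S_down f n P \<sigma> T \<rho>"
proof (cases "idle \<tau> = 0")
  \<comment> \<open>\<open>f_antimono\<close> says nothing at p = 1, but the factor q = 0 removes
    \<open>f 1\<close> from the downlink.\<close>
  case True
  then have "S_down f n P \<sigma> T \<tau> = 0" by (simp add: S_down_eq)
  then show ?thesis using S_down_pos[OF assms(2,3)] by simp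
next
  case False
  then have q: "0 < idle \<tau>" "idle \<tau> \<le> 1" "idle \<rho> \<le> 1"
    using idle_bounds assms by (auto simp: order_less_le)
  have "f (1 - idle \<tau>) \<le> f (1 - idle \<rho>)"
    using q assms by (intro f_antimono) auto
  then have "f (1 - idle \<tau>) * idle \<tau> / slot (idle \<tau>) \<le> f (1 - idle \<rho>) * idle \<rho> / slot (idle \<rho>)"
    unfolding slot_def using q assms f_bounds[of "idle \<tau>"] f_bounds[of "idle \<rho>"] sigma_pos sigma_less
    by (intro down_ratio_mono) auto
  then show ?thesis
    unfolding S_down_eq using P_pos by (intro mult_left_mono) auto
qed

lemma S_up_mono_own:
  assumes "outcome n \<tau>" "i \<in> {1..n}" "0 < idle \<tau>" "0 \<le> t" "t \<le> \<tau> i"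
  shows "S_up f n P \<sigma> T (\<tau>(i := t)) i \<le> S_up f n P \<sigma> T \<tau> i"
proof -
  let ?a = "idle_others \<tau> i"
  have a: "0 \<le> ?a" "?a \<le> 1" using idle_others_bounds assms(1) by auto
  have ti: "\<tau> i \<le> 1" using assms by (auto simp: outcome_def)
  have q: "idle \<tau> = (1 - \<tau> i) * ?a" "idle (\<tau>(i := t)) = (1 - t) * ?a"
    using idle_split[OF assms(2), of \<tau>] idle_split[OF assms(2), of "\<tau>(i := t)"] by auto
  have le: "idle \<tau> \<le> idle (\<tau>(i := t))"
    unfolding q using assms a by (intro mult_right_mono) auto
  have le1: "idle (\<tau>(i := t)) \<le> 1"
    unfolding q using assms a ti by (intro mult_le_one) auto
  have "f (1 - idle \<tau>) \<le> f (1 - idle (\<tau>(i := t)))"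
    using le le1 assms by (intro f_antimono) auto
  then have "t * ?a * (1 - f (1 - idle (\<tau>(i := t)))) /
        (T - (T - \<sigma>) * ((1 - t) * ?a * (1 - f (1 - idle (\<tau>(i := t)))))) \<le>
      \<tau> i * ?a * (1 - f (1 - idle \<tau>)) / (T - (T - \<sigma>) * ((1 - \<tau> i) * ?a * (1 - f (1 - idle \<tau>))))"
    using assms a ti le le1 f_bounds[of "idle \<tau>"] f_bounds[of "idle (\<tau>(i := t))"]
      sigma_pos sigma_less
    by (intro up_ratio_mono) auto
  then have "P * (t * ?a * (1 - f (1 - idle (\<tau>(i := t)))) / slot (idle (\<tau>(i := t)))) \<le>
      P * (\<tau> i * ?a * (1 - f (1 - idle \<tau>)) / slot (idle \<tau>))"
    unfolding slot_def using P_pos q by (intro mult_left_mono) auto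
  then show ?thesis by (simp add: S_up_eq ac_simps)
qed

text \<open>Equal idle products q give equal \<open>f\<close> and equal slot durations, so only
  \<open>\<rho> i * idle_others \<rho> i\<close> is to be compared. As
  \<open>idle_others \<rho> i\<close> is q / (1 - \<open>\<rho> i\<close>), it grows with
  \<open>\<rho> i\<close>.\<close>

lemma S_up_le_homogeneous:
  assumes "outcome n \<rho>" "i \<in> {1..n}" "0 \<le> t" "t < 1" "\<rho> i \<le> t" "idle \<rho> = (1 - t) ^ n"
  shows "S_up f n P \<sigma> T \<rho> i \<le> S_up_hom f n P \<sigma> T t"
proof -
  have q: "0 < idle \<rho>" "idle \<rho> \<le> 1" using assms(4,6) idle_bounds(2)[OF assms(1)] by auto
  have split: "(1 - \<rho> i) * idle_others \<rho> i = idle \<rho>" "(1 - t) * (1 - t) ^ (n - 1) = idle \<rho>"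
    using assms idle_split[of i \<rho>] idle_split[of i "\<lambda>_. t"] by (auto simp: idle_others_const)
  have "(1 - t) * idle_others \<rho> i \<le> (1 - \<rho> i) * idle_others \<rho> i"
    using assms idle_others_bounds by (intro mult_right_mono) auto
  then have "(1 - t) * idle_others \<rho> i \<le> (1 - t) * (1 - t) ^ (n - 1)"
    using split by simp
  then have "idle_others \<rho> i \<le> (1 - t) ^ (n - 1)"
    using assms by simp
  \<comment> \<open>Each side is the corresponding side of the previous inequality minus q.\<close>
  then have "\<rho> i * idle_others \<rho> i \<le> t * (1 - t) ^ (n - 1)"
    using split by (simp add: algebra_simps)
  then have "\<rho> i * idle_others \<rho> i * (1 - f (1 - idle \<rho>)) * P / slot (idle \<rho>)
      \<le> t * (1 - t) ^ (n - 1) * (1 - f (1 - idle \<rho>)) * P / slot (idle \<rho>)"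
    using f_bounds[OF q] slot_pos[OF q] P_pos
    by (intro divide_right_mono mult_right_mono) auto
  moreover have "S_up_hom f n P \<sigma> T t = S_up f n P \<sigma> T (\<lambda>_. t) i"
    using assms S_up_homogeneous by simp
  ultimately show ?thesis
    using assms by (simp add: S_up_eq idle_others_const)
qed

lemma up_eq_down_at_fixed_point:
  assumes "0 < k" "0 < t" "t < 1"
    and "t = k * f (1 - (1 - t) ^ n) / (real n - (real n - k) * f (1 - (1 - t) ^ n))"
  shows "S_up_hom f n P \<sigma> T t = k * S_down f n P \<sigma> T (\<lambda>_. t)"
proof -
  let ?f = "f (1 - (1 - t) ^ n)"
  have fb: "0 < ?f" "?f < 1"
    using assms by (auto intro!: f_bounds power_le_one)
  \<comment> \<open>A convex combination of n and k, hence positive also for k > n.\<close>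
  have "real n - (real n - k) * ?f = real n * (1 - ?f) + k * ?f"
    by (simp add: algebra_simps)
  also have "\<dots> > 0" using fb n_pos assms by (intro add_pos_pos mult_pos_pos) auto
  finally have "t * (real n - (real n - k) * ?f) = k * ?f"
    using assms(4) by (simp add: field_simps)
  then have eq: "real n * (t * (1 - ?f)) = k * ?f * (1 - t)"
    by (simp add: algebra_simps)
  have one: "1 \<in> {1..n}" using n_pos by simp
  have "S_up_hom f n P \<sigma> T t
      = real n * (t * (1 - ?f)) * ((1 - t) ^ (n - 1) * P / slot ((1 - t) ^ n)) / real n"
    using one n_pos by (simp add: S_up_hom_def S_up_eq idle_others_const)
  also have "\<dots> = k * (P / real n * (?f * ((1 - t) * (1 - t) ^ (n - 1)) / slot ((1 - t) ^ n)))"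
    unfolding eq by (simp add: ac_simps)
  also have "(1 - t) * (1 - t) ^ (n - 1) = (1 - t) ^ n"
    using n_pos by (simp add: power_eq_if)
  finally show ?thesis by (simp add: S_down_eq)
qed

section \<open>Equilibrium and Pareto optimality\<close>

text \<open>Both arguments of the minimum agree at t, so a deviation fails as soon as one of them
  does not increase.\<close>

lemma nash_equilibrium_homogeneous:
  assumes "0 < k" "0 < t" "t < 1"
    and eq: "S_up_hom f n P \<sigma> T t = k * S_down f n P \<sigma> T (\<lambda>_. t)"
  shows "nash_equilibrium n (utility f n k P \<sigma> T) (\<lambda>_. t)"
  unfolding nash_equilibrium_def
proof (intro conjI notI)
  let ?h = "\<lambda>_::nat. t"
  show out: "outcome n ?h" using assms by (simp add: outcome_def)
  assume "\<exists>i\<in>{1..n}. \<exists>s\<in>{0..1}. utility f n k P \<sigma> T ?h i < utility f n k P \<sigma> T (?h(i := s)) i"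
  then obtain i s where i: "i \<in> {1..n}" and s: "0 \<le> s" "s \<le> 1"
    and less: "utility f n k P \<sigma> T ?h i < utility f n k P \<sigma> T (?h(i := s)) i"
    by auto
  have S: "S_up f n P \<sigma> T ?h i = k * S_down f n P \<sigma> T ?h"
    using S_up_homogeneous[OF i] eq by simp
  have pos: "0 < idle ?h" using assms by simp
  show False
  proof (cases "s \<le> t")
    case True
    then show False
      using S_up_mono_own[OF out i pos s(1)] less S by (simp add: utility_def)
  next
    case False
    have "idle (?h(i := s)) \<le> idle ?h"
      using idle_split[OF i, of "?h(i := s)"] idle_split[OF i, of ?h] False
        idle_others_bounds(1)[OF out, of i]
      by (auto intro!: mult_right_mono)
    moreover have "outcome n (?h(i := s))" using assms s by (simp add: outcome_def)
    \<comment> \<open>For s = 1 the new idle product is 0; \<open>S_down_mono\<close> asks for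
      positivity of the larger one only.\<close>
    ultimately have "S_down f n P \<sigma> T (?h(i := s)) \<le> S_down f n P \<sigma> T ?h"
      using out pos by (intro S_down_mono)
    then have "k * S_down f n P \<sigma> T (?h(i := s)) \<le> k * S_down f n P \<sigma> T ?h"
      using assms(1) by (intro mult_left_mono) auto
    then show False using less S by (simp add: utility_def)
  qed
qed

lemma pareto_optimal_homogeneous:
  assumes "0 < k" "0 < t" "t < 1"
    and eq: "S_up_hom f n P \<sigma> T t = k * S_down f n P \<sigma> T (\<lambda>_. t)"
    and mono: "strict_mono_on {0..t} (S_up_hom f n P \<sigma> T)"
  shows "pareto_optimal n (utility f n k P \<sigma> T) (\<lambda>_. t)"
  unfolding pareto_optimal_def
proof (intro conjI notI)
  let ?h = "\<lambda>_::nat. t" and ?u = "utility f n k P \<sigma> T"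
  show out: "outcome n ?h" using assms by (simp add: outcome_def)
  assume "\<exists>\<rho>. outcome n \<rho> \<and> (\<forall>i\<in>{1..n}. ?u ?h i \<le> ?u \<rho> i) \<and> (\<exists>j\<in>{1..n}. ?u ?h j < ?u \<rho> j)"
  then obtain \<rho> j where \<rho>: "outcome n \<rho>" and ge: "\<And>i. i \<in> {1..n} \<Longrightarrow> ?u ?h i \<le> ?u \<rho> i"
    and j: "j \<in> {1..n}" "?u ?h j < ?u \<rho> j"
    by auto
  have u: "?u ?h i = S_up_hom f n P \<sigma> T t" "?u ?h i = k * S_down f n P \<sigma> T ?h"
    if "i \<in> {1..n}" for i
    using S_up_homogeneous[OF that] eq by (simp_all add: utility_def)
  have pos: "0 < idle ?h" using assms by simp
  \<comment> \<open>All stations share the downlink, so the gain of j alone forces it up.\<close>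
  have "k * S_down f n P \<sigma> T ?h < k * S_down f n P \<sigma> T \<rho>"
    using j u by (auto simp: utility_def)
  then have "S_down f n P \<sigma> T ?h < S_down f n P \<sigma> T \<rho>"
    using assms(1) by simp
  then have q: "(1 - t) ^ n < idle \<rho>"
    using S_down_mono[OF \<rho> out pos] by force
  \<comment> \<open>The homogeneous strategy with the same idle product as
    \<open>\<rho>\<close>.\<close>
  define s where "s = 1 - root n (idle \<rho>)"
  have q0: "0 \<le> idle \<rho>" "idle \<rho> \<le> 1" using idle_bounds \<rho> by auto
  have sn: "idle \<rho> = (1 - s) ^ n" using q0 n_pos by (simp add: s_def)
  have "root n ((1 - t) ^ n) < root n (idle \<rho>)" using q n_pos by simp
  then have st: "s < t" using assms n_pos by (simp add: s_def real_root_power_cancel)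
  have s0: "0 \<le> s" using q0 n_pos by (simp add: s_def)
  \<comment> \<open>If every station exceeded s, the product would drop below (1 - s)^n.\<close>
  obtain i where i: "i \<in> {1..n}" "\<rho> i \<le> s"
  proof (rule ccontr)
    assume "\<not> thesis"
    then have "\<And>i. i \<in> {1..n} \<Longrightarrow> s < \<rho> i" using that by force
    then have "idle \<rho> < (\<Prod>j\<in>{1..n}. 1 - s)"
      unfolding idle_def using \<rho> n_pos st assms
      by (intro prod_mono_strict) (auto simp: outcome_def intro: less_imp_le)
    then show False using sn by simp
  qed
  have "S_up f n P \<sigma> T \<rho> i \<le> S_up_hom f n P \<sigma> T s"
    using \<rho> i s0 st assms sn by (intro S_up_le_homogeneous) auto
  moreover have "S_up_hom f n P \<sigma> T s < S_up_hom f n P \<sigma> T t"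
    using mono s0 st by (auto simp: strict_mono_on_def)
  moreover have "S_up_hom f n P \<sigma> T t \<le> S_up f n P \<sigma> T \<rho> i"
    using ge[OF i(1)] u(1)[OF i(1)] by (simp add: utility_def)
  ultimately show False by simp
qed

end

theorem proposition2p5:
  fixes n R :: nat and k P \<sigma> T CWmin CWmax \<tau>s \<tau>x :: real
  assumes "n \<ge> 2" and "k > 0" and "P > 0" and "0 < \<sigma>" and "\<sigma> < T"
    and "1 < CWmin" and "CWmin \<le> CWmax"
    and "\<tau>s \<in> {0<..<1}"
    and "\<tau>s = k * attempt_prob R CWmin CWmax (1 - (1 - \<tau>s) ^ n) /
           (real n - (real n - k) * attempt_prob R CWmin CWmax (1 - (1 - \<tau>s) ^ n))"
    and "\<tau>x \<in> {0<..<1}"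
    and "strict_mono_on {0..\<tau>x} (S_up_hom (attempt_prob R CWmin CWmax) n P \<sigma> T)"
    and "strict_antimono_on {\<tau>x..1} (S_up_hom (attempt_prob R CWmin CWmax) n P \<sigma> T)"
    and "\<tau>s \<le> \<tau>x"
  shows "nash_equilibrium n (utility (attempt_prob R CWmin CWmax) n k P \<sigma> T) (\<lambda>_. \<tau>s) \<and>
         pareto_optimal n (utility (attempt_prob R CWmin CWmax) n k P \<sigma> T) (\<lambda>_. \<tau>s)"
proof -
  interpret access_game "attempt_prob R CWmin CWmax" n P \<sigma> T
    using assms attempt_prob_bounds[OF assms(6,7)] attempt_prob_antimono[OF assms(6,7)]
    by unfold_locales auto
  have t: "0 < \<tau>s" "\<tau>s < 1" using assms(8) by auto
  note eq = up_eq_down_at_fixed_point[OF assms(2) t assms(9)]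
  \<comment> \<open>Here \<open>\<tau>s \<le> \<tau>x\<close> enters: [0, \<open>\<tau>s\<close>]
    lies in the increasing branch.\<close>
  have "strict_mono_on {0..\<tau>s} (S_up_hom (attempt_prob R CWmin CWmax) n P \<sigma> T)"
    using assms(11,13) by (auto intro: monotone_on_subset)
  then show ?thesis
    using nash_equilibrium_homogeneous[OF assms(2) t eq]
      pareto_optimal_homogeneous[OF assms(2) t eq] by blast
qed

end
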